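(* For a positive integer $n$, let $G$ be a disjoint union of $n$ triangles, with vertex set $V(G)=\{u_i,v_i,w_i:1\leq i\leq n\}$ and edge set $E(G)=\{u_iv_i,v_iw_i,w_iu_i:1\leq i\leq n\}$. Let $k$ be the minimum positive integer such that $\binom{k}{3}\geq n$. Then $s(G)=k$, and $s(G)-\chi'(G)=\Theta(n^{1/3})$ as $n\to\infty$.
   Context: A vertex labeling of a graph $G$ is an injective map $f:V(G)\to\mathbb{Z}$. It induces the edge labeling $f^+:E(G)\to\mathbb{Z}$, $f^+(uv)=f(u)+f(v)$, and $|f^+|$ denotes the number of distinct values $f^+$ takes on $E(G)$. The sum index $s(G)$ is the minimum positive integer $k$ such that there exists a vertex labeling $f$ of $G$ with $|f^+|=k$. The chromatic index $\chi'(G)$ is the minimum number of colors in a proper edge coloring of $G$. *)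

theory Defs
  imports Complex_Main "HOL-Library.Landau_Symbols"
begin

text \<open>
  A graph is given by a vertex set \<open>V\<close> and an edge set \<open>E\<close> of unordered pairs of vertices.
\<close>

definition simple_graph :: "'a set \<Rightarrow> 'a set set \<Rightarrow> bool" where
  "simple_graph V E \<longleftrightarrow> finite V \<and> (\<forall>e\<in>E. e \<subseteq> V \<and> card e = 2)"

definition vertex_labeling :: "'a set \<Rightarrow> ('a \<Rightarrow> int) \<Rightarrow> bool" where
  "vertex_labeling V f \<longleftrightarrow> inj_on f V"

text \<open>For an edge \<open>e = {u, v}\<close> with \<open>u \<noteq> v\<close> the following sum is \<open>f u + f v\<close>.\<close>

definition induced_label :: "('a \<Rightarrow> int) \<Rightarrow> 'a set \<Rightarrow> int" where
  "induced_label f e = (\<Sum>x\<in>e. f x)"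

definition sum_index :: "'a set \<Rightarrow> 'a set set \<Rightarrow> nat" where
  "sum_index V E =
     (LEAST k. 0 < k \<and> (\<exists>f. vertex_labeling V f \<and> card (induced_label f ` E) = k))"

definition proper_edge_coloring :: "'a set set \<Rightarrow> ('a set \<Rightarrow> nat) \<Rightarrow> bool" where
  "proper_edge_coloring E c \<longleftrightarrow>
     (\<forall>e\<in>E. \<forall>e'\<in>E. e \<noteq> e' \<and> e \<inter> e' \<noteq> {} \<longrightarrow> c e \<noteq> c e')"

definition chromatic_index :: "'a set set \<Rightarrow> nat" where
  "chromatic_index E = (LEAST k. \<exists>c. proper_edge_coloring E c \<and> card (c ` E) = k)"

definition disjoint_triangles :: "nat \<Rightarrow> 'a set \<Rightarrow> 'a set set \<Rightarrow> bool" where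
  "disjoint_triangles n V E \<longleftrightarrow>
     (\<exists>u v w. inj_on u {1..n} \<and> inj_on v {1..n} \<and> inj_on w {1..n} \<and>
        u ` {1..n} \<inter> v ` {1..n} = {} \<and> v ` {1..n} \<inter> w ` {1..n} = {} \<and>
        w ` {1..n} \<inter> u ` {1..n} = {} \<and>
        V = (\<Union>i\<in>{1..n}. {u i, v i, w i}) \<and>
        E = (\<Union>i\<in>{1..n}. {{u i, v i}, {v i, w i}, {w i, u i}}))"

definition min_choose3 :: "nat \<Rightarrow> nat" where
  "min_choose3 n = (LEAST k. 0 < k \<and> n \<le> k choose 3)"

lemma induced_label_edge: "u \<noteq> v \<Longrightarrow> induced_label f {u, v} = f u + f v"
  by (simp add: induced_label_def)

lemma disjoint_triangles_simple_graph:
  assumes "disjoint_triangles n V E"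
  shows "simple_graph V E"
proof -
  obtain u v w where
    d: "u ` {1..n} \<inter> v ` {1..n} = {}" "v ` {1..n} \<inter> w ` {1..n} = {}"
       "w ` {1..n} \<inter> u ` {1..n} = {}"
    and V: "V = (\<Union>i\<in>{1..n}. {u i, v i, w i})"
    and E: "E = (\<Union>i\<in>{1..n}. {{u i, v i}, {v i, w i}, {w i, u i}})"
    using assms unfolding disjoint_triangles_def by blast
  have ne: "u i \<noteq> v i \<and> v i \<noteq> w i \<and> w i \<noteq> u i" if "i \<in> {1..n}" for i
    using d that by (metis IntI empty_iff imageI)
  have "finite V" using V by simp
  moreover have "e \<subseteq> V \<and> card e = 2" if eE: "e \<in> E" for e
  proof -
    obtain i where i: "i \<in> {1..n}" "e \<in> {{u i, v i}, {v i, w i}, {w i, u i}}"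
      using eE E by blast
    have "e \<subseteq> {u i, v i, w i}" using i by auto
    then have "e \<subseteq> V" using V i(1) by blast
    moreover have "card e = 2" using i(2) ne[OF i(1)] by auto
    ultimately show ?thesis by simp
  qed
  ultimately show ?thesis unfolding simple_graph_def by blast
qed

lemma disjoint_triangles_exist: "\<exists>V E. disjoint_triangles n (V :: nat set) E"
proof -
  define u v w :: "nat \<Rightarrow> nat" where "u = (\<lambda>i. 3 * i)" and "v = (\<lambda>i. 3 * i + 1)"
    and "w = (\<lambda>i. 3 * i + 2)"
  have "u i \<noteq> v j" "v i \<noteq> w j" "w i \<noteq> u j" for i j
    unfolding u_def v_def w_def by presburger+
  then have "u ` {1..n} \<inter> v ` {1..n} = {}" "v ` {1..n} \<inter> w ` {1..n} = {}"
    "w ` {1..n} \<inter> u ` {1..n} = {}"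
    by blast+
  moreover have "inj_on u {1..n}" "inj_on v {1..n}" "inj_on w {1..n}"
    by (simp_all add: inj_on_def u_def v_def w_def)
  ultimately show ?thesis
    unfolding disjoint_triangles_def by blast
qed

end

theory Submission
  imports Defs
begin

text \<open>
  Why the sum index is \<open>k\<close>.  Three numbers \<open>x, y, z\<close> can be recovered from their pairwise sums:
  \<open>x + y + z\<close> is half the total of the three sums, and each number is that value minus one sum.
  Under an injective vertex labeling the three edge labels of a triangle are distinct, and different
  triangles therefore use different 3-sets of edge labels; so \<open>m\<close> edge labels serve at most
  \<open>m choose 3\<close> triangles (\<open>triangles_le_choose\<close>).  Conversely one may prescribe the edge labels:
  give each triangle its own 3-set \<open>{a, b, c}\<close> taken from \<open>k\<close> fixed even integers and label its
  vertices \<open>(a + b - c) / 2\<close>, \<open>(a + c - b) / 2\<close>, \<open>(b + c - a) / 2\<close>.  The edge sums are then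
  \<open>a\<close>, \<open>b\<close>, \<open>c\<close>, so at most \<open>k\<close> edge labels occur, and by the first half at least \<open>k\<close> do.
  What remains is to choose the integers so that no two vertices collide; the numbers \<open>2 * 4 ^ x\<close>
  for \<open>x < k\<close> work, because a collision would give one integer two expansions in base 4
  (\<open>vertex_value_inject\<close>).

  Why the difference has order \<open>n powr (1/3)\<close>.  Colouring each edge by the kind of its two
  endpoints shows that the chromatic index is at most 3, so only \<open>k\<close> matters, and \<open>k choose 3\<close> is
  squeezed between two constant multiples of \<open>k ^ 3\<close>.
\<close>

section \<open>Labels that are determined by their base 4 digits\<close>

lemma digits_unique:
  fixes d e :: "nat \<Rightarrow> int"
  assumes "(\<Sum>x<k. d x * b ^ x) = (\<Sum>x<k. e x * b ^ x)"
    and "\<And>x. 0 \<le> d x \<and> d x < b" "\<And>x. 0 \<le> e x \<and> e x < b" "x < k"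
  shows "d x = e x"
  using assms
proof (induction k arbitrary: d e x)
  case 0
  then show ?case by simp
next
  case (Suc k)
  let ?D = "\<Sum>x<k. d (Suc x) * b ^ x" and ?E = "\<Sum>x<k. e (Suc x) * b ^ x"
  have split: "(\<Sum>x<Suc k. c x * b ^ x) = c 0 + b * (\<Sum>x<k. c (Suc x) * b ^ x)"
    for c :: "nat \<Rightarrow> int"
    by (simp add: sum.lessThan_Suc_shift sum_distrib_left mult.left_commute del: sum.lessThan_Suc)
  have eq: "d 0 + b * ?D = e 0 + b * ?E"
    using Suc.prems(1) unfolding split .
  then have "(d 0 + b * ?D) mod b = (e 0 + b * ?E) mod b"
    by simp
  then have zero: "d 0 = e 0"
    using Suc.prems(2)[of 0] Suc.prems(3)[of 0] by simp
  have "b > 0"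
    using Suc.prems(2)[of 0] by linarith
  with eq zero have tail: "?D = ?E"
    by simp
  show ?case
  proof (cases x)
    case 0
    with zero show ?thesis by simp
  next
    case (Suc y)
    then show ?thesis
      using Suc.IH[of "\<lambda>x. d (Suc x)" "\<lambda>x. e (Suc x)" y] tail Suc.prems by simp
  qed
qed

text \<open>
  For \<open>T = {p, q, r}\<close> and \<open>c = r\<close> this is \<open>(a + b - c') / 2\<close> for the prescribed edge labels
  \<open>a = 2 * 4 ^ p\<close>, \<open>b = 2 * 4 ^ q\<close>, \<open>c' = 2 * 4 ^ r\<close>: the label of the vertex opposite to the edge
  that is to receive \<open>2 * 4 ^ r\<close>.
\<close>

definition vertex_value :: "nat set \<Rightarrow> nat \<Rightarrow> int" where
  "vertex_value T c = (\<Sum>x\<in>T. 4 ^ x) - 2 * 4 ^ c"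

lemma vertex_value_add:
  assumes "p \<noteq> q" "q \<noteq> r" "r \<noteq> p"
  shows "vertex_value {p, q, r} p + vertex_value {p, q, r} q = 2 * 4 ^ r"
  using assms by (simp add: vertex_value_def)

text \<open>
  Moving the negative terms of \<open>vertex_value T c = vertex_value T' c'\<close> to the other side leaves sums
  of powers of 4 whose coefficient at \<open>4 ^ x\<close> is \<open>1\<close> if \<open>x\<close> lies in the set, plus \<open>2\<close> if \<open>x\<close> is the
  mark (\<open>c'\<close> next to \<open>T\<close>, \<open>c\<close> next to \<open>T'\<close>).  These coefficients are base 4 digits, so they agree; their parity recovers the set
  and their upper bit the mark.
\<close>

lemma vertex_value_inject:
  assumes T: "T \<subseteq> {..<k}" "c < k" and T': "T' \<subseteq> {..<k}" "c' < k"
    and eq: "vertex_value T c = vertex_value T' c'"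
  shows "T = T' \<and> c = c'"
proof -
  let ?d = "\<lambda>S m x. (if x \<in> S then 1 else 0) + (if x = m then 2 else 0) :: int"
  have digits: "(\<Sum>x<k. ?d S m x * 4 ^ x) = (\<Sum>x\<in>S. 4 ^ x) + 2 * 4 ^ m"
    if "S \<subseteq> {..<k}" "m < k" for S m
  proof -
    have "(\<Sum>x<k. ?d S m x * 4 ^ x) =
        (\<Sum>x<k. if x \<in> S then 4 ^ x else 0) + (\<Sum>x<k. if x = m then 2 * 4 ^ x else 0)"
      unfolding sum.distrib[symmetric] by (intro sum.cong) auto
    also have "(\<Sum>x<k. if x \<in> S then 4 ^ x else (0::int)) = (\<Sum>x\<in>S. 4 ^ x)"
      using that(1) by (subst sum.inter_restrict[symmetric]) (auto simp: Int_absorb1)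
    also have "(\<Sum>x<k. if x = m then 2 * 4 ^ x else (0::int)) = 2 * 4 ^ m"
      using that(2) by simp
    finally show ?thesis .
  qed
  have "(\<Sum>x<k. ?d T c' x * 4 ^ x) = (\<Sum>x<k. ?d T' c x * 4 ^ x)"
    using eq T T' by (simp add: digits vertex_value_def)
  then have same: "?d T c' x = ?d T' c x" if "x < k" for x
    by (rule digits_unique[where k = k]) (use that in auto)
  have mem: "x \<in> T \<longleftrightarrow> x \<in> T'" if "x < k" for x
    using same[OF that] by (auto split: if_splits)
  have "T = T'"
    using mem T(1) T'(1) by blast
  moreover have "c = c'"
    using same[OF T(2)] mem[OF T(2)] by (auto split: if_splits)
  ultimately show ?thesis by blast
qed

section \<open>Disjoint triangles\<close>

locale triangles =
  fixes n :: nat and u v w :: "nat \<Rightarrow> 'a"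
  assumes inj: "inj_on u {1..n}" "inj_on v {1..n}" "inj_on w {1..n}"
    and disj: "u ` {1..n} \<inter> v ` {1..n} = {}" "v ` {1..n} \<inter> w ` {1..n} = {}"
      "w ` {1..n} \<inter> u ` {1..n} = {}"
begin

definition vertices :: "'a set" where
  "vertices = (\<Union>i\<in>{1..n}. {u i, v i, w i})"

definition edges :: "'a set set" where
  "edges = (\<Union>i\<in>{1..n}. {{u i, v i}, {v i, w i}, {w i, u i}})"

lemma index_eq [simp]:
  assumes "i \<in> {1..n}" "j \<in> {1..n}"
  shows "u i = u j \<longleftrightarrow> i = j" "v i = v j \<longleftrightarrow> i = j" "w i = w j \<longleftrightarrow> i = j"
    "u i \<noteq> v j" "v i \<noteq> u j" "v i \<noteq> w j" "w i \<noteq> v j" "w i \<noteq> u j" "u i \<noteq> w j"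
proof -
  show "u i = u j \<longleftrightarrow> i = j" "v i = v j \<longleftrightarrow> i = j" "w i = w j \<longleftrightarrow> i = j"
    using inj assms by (metis inj_onD)+
  show "u i \<noteq> v j" "v i \<noteq> u j" "v i \<noteq> w j" "w i \<noteq> v j" "w i \<noteq> u j" "u i \<noteq> w j"
    using disj assms by (metis IntI empty_iff imageI)+
qed

lemma finite_edges: "finite edges"
  by (simp add: edges_def)

text \<open>Each triangle is recovered from its 3-set of edge labels, so there are at most as many
  triangles as there are 3-sets.\<close>

lemma triangles_le_choose:
  assumes f: "vertex_labeling vertices f"
  shows "n \<le> card (induced_label f ` edges) choose 3"
proof -
  let ?L = "induced_label f ` edges"
  define S where "S i = {f (u i) + f (v i), f (v i) + f (w i), f (w i) + f (u i)}" for i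
  define t where "t i = f (u i) + f (v i) + f (w i)" for i
  have f_eq: "f x = f y \<longleftrightarrow> x = y" if "x \<in> vertices" "y \<in> vertices" for x y
    using f that by (auto simp: vertex_labeling_def inj_on_def)
  have vert: "u i \<in> vertices" "v i \<in> vertices" "w i \<in> vertices" if "i \<in> {1..n}" for i
    using that by (auto simp: vertices_def)
  have ne: "f (u i) \<noteq> f (v i)" "f (v i) \<noteq> f (w i)" "f (w i) \<noteq> f (u i)"
    if "i \<in> {1..n}" for i
    using that vert[OF that] by (simp_all add: f_eq)
  have sub: "S i \<subseteq> ?L" if i: "i \<in> {1..n}" for i
  proof -
    have "{u i, v i} \<in> edges" "{v i, w i} \<in> edges" "{w i, u i} \<in> edges"
      using i by (auto simp: edges_def)
    then have "induced_label f {u i, v i} \<in> ?L" "induced_label f {v i, w i} \<in> ?L"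
      "induced_label f {w i, u i} \<in> ?L"
      by blast+
    then show ?thesis
      using i by (simp add: S_def induced_label_edge)
  qed
  have card: "card (S i) = 3" if "i \<in> {1..n}" for i
    using ne[OF that] by (auto simp: S_def)
  have sum: "\<Sum>(S i) = 2 * t i" if "i \<in> {1..n}" for i
    using ne[OF that] by (auto simp: S_def t_def)
  have labels: "f ` {u i, v i, w i} = (\<lambda>s. t i - s) ` S i" for i
    by (auto simp: S_def t_def)
  have "inj_on S {1..n}"
  proof (rule inj_onI)
    fix i j assume ij: "i \<in> {1..n}" "j \<in> {1..n}" and eq: "S i = S j"
    then have "t i = t j"
      using sum by (metis mult_cancel_left zero_neq_numeral)
    then have "f ` {u i, v i, w i} = f ` {u j, v j, w j}"
      by (simp only: labels eq)
    then have "f (u i) \<in> f ` {u j, v j, w j}"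
      by blast
    then have "u i \<in> {u j, v j, w j}"
      using ij by (auto simp: f_eq vert)
    then show "i = j"
      using ij by simp
  qed
  then have "card {1..n} \<le> card {A. A \<subseteq> ?L \<and> card A = 3}"
  proof (rule card_inj_on_le)
    show "S ` {1..n} \<subseteq> {A. A \<subseteq> ?L \<and> card A = 3}"
      using sub card by blast
  qed (use finite_edges in simp)
  then show ?thesis
    using finite_edges by (simp add: n_subsets)
qed

text \<open>Distributing the 3-subsets of \<open>{..<k}\<close> injectively among the triangles and labeling by
  \<open>vertex_value\<close> makes every edge label one of the \<open>k\<close> numbers \<open>2 * 4 ^ x\<close>.\<close>

lemma labeling_with_few_labels:
  assumes n: "n \<le> k choose 3"
  obtains f where "vertex_labeling vertices f" "card (induced_label f ` edges) \<le> k"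
proof -
  have "card {1..n} \<le> card {A. A \<subseteq> {..<k} \<and> card A = 3}"
    using n by (simp add: n_subsets)
  then obtain T where T: "T ` {1..n} \<subseteq> {A. A \<subseteq> {..<k} \<and> card A = 3}" "inj_on T {1..n}"
    by (rule card_le_inj[rotated 2, THEN exE]) auto
  have "\<forall>i\<in>{1..n}. \<exists>p q r. T i = {p, q, r} \<and> p \<noteq> q \<and> q \<noteq> r \<and> r \<noteq> p"
  proof
    fix i assume "i \<in> {1..n}"
    then have "card (T i) = 3" using T(1) by blast
    then show "\<exists>p q r. T i = {p, q, r} \<and> p \<noteq> q \<and> q \<noteq> r \<and> r \<noteq> p"
      unfolding card_3_iff by metis
  qed
  then obtain p q r where
    pqr: "\<And>i. i \<in> {1..n} \<Longrightarrow> T i = {p i, q i, r i} \<and> p i \<noteq> q i \<and> q i \<noteq> r i \<and> r i \<noteq> p i"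
    by metis
  have Tk: "T i \<subseteq> {..<k}" "p i < k" "q i < k" "r i < k" if "i \<in> {1..n}" for i
    using T(1) pqr[OF that] that by blast+
  define val where "val i = vertex_value (T i)" for i
  have val_eq: "val i c = val j d \<longleftrightarrow> i = j \<and> c = d"
    if "i \<in> {1..n}" "j \<in> {1..n}" "c < k" "d < k" for i j c d
  proof
    assume "val i c = val j d"
    then have "T i = T j \<and> c = d"
      unfolding val_def using that Tk(1) by (intro vertex_value_inject) blast+
    then show "i = j \<and> c = d"
      using that T(2) by (blast dest: inj_onD)
  qed simp
  define f where "f x =
      (if x \<in> u ` {1..n} then let i = the_inv_into {1..n} u x in val i (p i)
       else if x \<in> v ` {1..n} then let i = the_inv_into {1..n} v x in val i (q i)
       else let i = the_inv_into {1..n} w x in val i (r i))" for x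
  have fu: "f (u i) = val i (p i)" if "i \<in> {1..n}" for i
    using that inj by (simp add: f_def the_inv_into_f_f)
  have fv: "f (v i) = val i (q i)" if i: "i \<in> {1..n}" for i
  proof -
    have "v i \<notin> u ` {1..n}" using i disj by blast
    then show ?thesis using i inj by (simp add: f_def the_inv_into_f_f)
  qed
  have fw: "f (w i) = val i (r i)" if i: "i \<in> {1..n}" for i
  proof -
    have "w i \<notin> u ` {1..n}" "w i \<notin> v ` {1..n}" using i disj by blast+
    then show ?thesis using i inj by (simp add: f_def the_inv_into_f_f)
  qed
  have "vertex_labeling vertices f"
    unfolding vertex_labeling_def
  proof (rule inj_onI)
    fix x y assume xy: "x \<in> vertices" "y \<in> vertices" and eq: "f x = f y"
    from xy obtain i j where ij: "i \<in> {1..n}" "j \<in> {1..n}"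
      and x: "x \<in> {u i, v i, w i}" and y: "y \<in> {u j, v j, w j}"
      unfolding vertices_def by blast
    show "x = y"
      using x y eq ij Tk(2-4)[OF ij(1)] Tk(2-4)[OF ij(2)] pqr[OF ij(1)]
      by (auto simp: fu fv fw val_eq simp del: atLeastAtMost_iff)
  qed
  moreover have "induced_label f ` edges \<subseteq> (\<lambda>x. 2 * 4 ^ x) ` {..<k}"
  proof
    fix l assume "l \<in> induced_label f ` edges"
    then obtain i e where i: "i \<in> {1..n}" and e: "e \<in> {{u i, v i}, {v i, w i}, {w i, u i}}"
      and l: "l = induced_label f e"
      unfolding edges_def by blast
    \<comment> \<open>The two other edges are the same identity after rotating \<open>{p, q, r}\<close>.\<close>
    have rot: "{p i, q i, r i} = {q i, r i, p i}" "{p i, q i, r i} = {r i, p i, q i}"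
      by auto
    have "val i (p i) + val i (q i) = 2 * 4 ^ r i"
      using pqr[OF i] by (simp add: val_def vertex_value_add)
    moreover have "val i (q i) + val i (r i) = 2 * 4 ^ p i"
      using pqr[OF i] vertex_value_add[of "q i" "r i" "p i"] by (simp add: val_def rot(1))
    moreover have "val i (r i) + val i (p i) = 2 * 4 ^ q i"
      using pqr[OF i] vertex_value_add[of "r i" "p i" "q i"] by (simp add: val_def rot(2))
    ultimately have "l \<in> {2 * 4 ^ r i, 2 * 4 ^ p i, 2 * 4 ^ q i}"
      using e l i by (auto simp: induced_label_edge fu fv fw simp del: atLeastAtMost_iff)
    then show "l \<in> (\<lambda>x. 2 * 4 ^ x) ` {..<k}"
      using Tk[OF i] by blast
  qed
  then have "card (induced_label f ` edges) \<le> card {..<k}"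
    by (rule surj_card_le[rotated]) simp
  ultimately show ?thesis
    using that by simp
qed

text \<open>The colour of an edge records which of the three kinds of vertices it misses; within a
  triangle no two edges miss the same kind.\<close>

lemma chromatic_index_le: "chromatic_index edges \<le> 3"
proof -
  define c :: "'a set \<Rightarrow> nat" where
    "c e = (if e \<inter> w ` {1..n} = {} then 0 else if e \<inter> u ` {1..n} = {} then 1 else 2)" for e
  have c: "c {u i, v i} = 0" "c {v i, w i} = 1" "c {w i, u i} = 2" if "i \<in> {1..n}" for i
    using that disj by (auto simp: c_def)
  have "proper_edge_coloring edges c"
    unfolding proper_edge_coloring_def
  proof (intro ballI impI, elim conjE)
    fix e e' assume ee: "e \<in> edges" "e' \<in> edges" "e \<noteq> e'" "e \<inter> e' \<noteq> {}"
    from ee(1,2) obtain i j where ij: "i \<in> {1..n}" "j \<in> {1..n}"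
      and e: "e \<in> {{u i, v i}, {v i, w i}, {w i, u i}}"
      and e': "e' \<in> {{u j, v j}, {v j, w j}, {w j, u j}}"
      unfolding edges_def by blast
    from e e' have "e \<inter> e' \<subseteq> {u i, v i, w i} \<inter> {u j, v j, w j}"
      by auto
    with ee(4) obtain x where "x \<in> {u i, v i, w i}" "x \<in> {u j, v j, w j}"
      by auto
    then have "i = j"
      using ij by (auto simp del: atLeastAtMost_iff)
    then show "c e \<noteq> c e'"
      using e e' ee(3) c[OF ij(1)] by auto
  qed
  then have "chromatic_index edges \<le> card (c ` edges)"
    unfolding chromatic_index_def by (intro Least_le) blast
  also have "\<dots> \<le> card {0, 1, 2 :: nat}"
    by (rule card_mono) (auto simp: c_def)
  finally show ?thesis by simp
qed

end

lemma disjoint_trianglesE: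
  assumes "disjoint_triangles n V E"
  obtains u v w where "triangles n u v w" "V = triangles.vertices n u v w"
    "E = triangles.edges n u v w"
proof -
  obtain u v w where "inj_on u {1..n} \<and> inj_on v {1..n} \<and> inj_on w {1..n} \<and>
        u ` {1..n} \<inter> v ` {1..n} = {} \<and> v ` {1..n} \<inter> w ` {1..n} = {} \<and>
        w ` {1..n} \<inter> u ` {1..n} = {}"
      and VE: "V = (\<Union>i\<in>{1..n}. {u i, v i, w i})"
        "E = (\<Union>i\<in>{1..n}. {{u i, v i}, {v i, w i}, {w i, u i}})"
    using assms unfolding disjoint_triangles_def by blast
  then have t: "triangles n u v w"
    by unfold_locales auto
  show ?thesis
    by (rule that[OF t])
      (simp_all only: VE triangles.vertices_def[OF t] triangles.edges_def[OF t])
qed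

section \<open>The sum index\<close>

lemma min_choose3:
  shows min_choose3_pos: "0 < min_choose3 n"
    and le_min_choose3: "n \<le> min_choose3 n choose 3"
proof -
  have "m \<le> m + 3 choose 3" for m
  proof (induction m)
    case (Suc m)
    have "Suc m + 3 choose 3 = (m + 3 choose 2) + (m + 3 choose 3)"
      by (simp add: numeral_3_eq_3 numeral_2_eq_2)
    moreover have "0 < m + 3 choose 2"
      by simp
    ultimately show ?case
      using Suc by linarith
  qed simp
  then have "0 < n + 3 \<and> n \<le> n + 3 choose 3"
    by simp
  then have "0 < min_choose3 n \<and> n \<le> min_choose3 n choose 3"
    unfolding min_choose3_def by (rule LeastI)
  then show "0 < min_choose3 n" "n \<le> min_choose3 n choose 3"
    by auto
qed

lemma min_choose3_le: "0 < k \<Longrightarrow> n \<le> k choose 3 \<Longrightarrow> min_choose3 n \<le> k"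
  unfolding min_choose3_def by (rule Least_le) blast

lemma sum_index_eq_min_choose3:
  assumes n: "1 \<le> n" and "disjoint_triangles n V E"
  shows "sum_index V E = min_choose3 n"
proof -
  from assms(2) obtain u v w where t: "triangles n u v w"
    and V: "V = triangles.vertices n u v w" and E: "E = triangles.edges n u v w"
    by (rule disjoint_trianglesE)
  interpret triangles n u v w by (rule t)
  have lower: "min_choose3 n \<le> card (induced_label f ` E)" if "vertex_labeling V f" for f
  proof (rule min_choose3_le)
    show "n \<le> card (induced_label f ` E) choose 3"
      using triangles_le_choose that by (simp add: V E)
    with n show "0 < card (induced_label f ` E)"
      by (intro gr0I) (simp add: binomial_eq_0)
  qed
  obtain f where f: "vertex_labeling V f" "card (induced_label f ` E) \<le> min_choose3 n"
    using labeling_with_few_labels[OF le_min_choose3] by (auto simp: V E)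
  show ?thesis
    unfolding sum_index_def
  proof (rule Least_equality)
    show "0 < min_choose3 n \<and>
        (\<exists>f. vertex_labeling V f \<and> card (induced_label f ` E) = min_choose3 n)"
      using f lower min_choose3_pos by (meson le_antisym)
  qed (use lower in auto)
qed

section \<open>Growth\<close>

lemma cube_powr_third:
  assumes "0 < x"
  shows "(x ^ 3) powr (1 / 3) = (x :: real)"
proof -
  have "x ^ 3 = x powr 3"
    using powr_realpow[of x 3] assms by simp
  then have "(x ^ 3) powr (1 / 3) = x powr (3 * (1 / 3))"
    by (simp only: powr_powr)
  then show ?thesis
    using assms by simp
qed

lemma min_choose3_ge_cube_root: "real n powr (1 / 3) \<le> real (min_choose3 n)"
proof -
  let ?k = "min_choose3 n"
  have "?k choose 3 \<le> ?k ^ 3"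
    by (cases "3 \<le> ?k") (auto simp: binomial_le_pow binomial_eq_0)
  with le_min_choose3[of n] have "real n \<le> real ?k ^ 3"
    by (metis of_nat_le_iff of_nat_power order_trans)
  then have "real n powr (1 / 3) \<le> (real ?k ^ 3) powr (1 / 3)"
    by (intro powr_mono2) auto
  also have "\<dots> = real ?k"
    using min_choose3_pos[of n] by (simp add: cube_powr_third)
  finally show ?thesis .
qed

text \<open>The predecessor of the minimum still fails, and \<open>(m / 3) ^ 3 \<le> m choose 3\<close> once
  \<open>3 \<le> m\<close>; for smaller \<open>m\<close> the bound is absorbed by \<open>1 \<le> n powr (1 / 3)\<close>.\<close>

lemma min_choose3_le_cube_root:
  assumes "1 \<le> n"
  shows "real (min_choose3 n) \<le> 1 + 3 * real n powr (1 / 3)"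
proof -
  define m where "m = min_choose3 n - 1"
  have k: "min_choose3 n = m + 1"
    using min_choose3_pos[of n] by (simp add: m_def)
  have "real m / 3 \<le> real n powr (1 / 3)"
  proof (cases "3 \<le> m")
    case True
    have "m choose 3 < n"
      using min_choose3_le[of m n] k True by fastforce
    then have "real (m choose 3) \<le> real n"
      by simp
    with binomial_ge_n_over_k_pow_k[OF True, where ?'a = real]
    have "(real m / 3) ^ 3 \<le> real n"
      by simp
    then have "((real m / 3) ^ 3) powr (1 / 3) \<le> real n powr (1 / 3)"
      by (intro powr_mono2) auto
    moreover have "((real m / 3) ^ 3) powr (1 / 3) = real m / 3"
      using True by (intro cube_powr_third) simp
    ultimately show ?thesis by simp
  next
    case False
    then have "real m / 3 \<le> 1" by simp
    also have "1 \<le> real n powr (1 / 3)"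
      using assms by (simp add: ge_one_powr_ge_zero)
    finally show ?thesis .
  qed
  then show ?thesis by (simp add: k)
qed

theorem theorem2p6:
  shows "(\<forall>n (V :: 'a set) E. 1 \<le> n \<and> disjoint_triangles n V E \<longrightarrow>
            sum_index V E = min_choose3 n) \<and>
         (\<forall>(V :: nat \<Rightarrow> 'a set) E. (\<forall>n\<ge>1. disjoint_triangles n (V n) (E n)) \<longrightarrow>
            (\<lambda>n. real (sum_index (V n) (E n)) - real (chromatic_index (E n)))
              \<in> \<Theta>(\<lambda>n. real n powr (1 / 3)))"
proof (intro conjI allI impI)
  fix n and V :: "'a set" and E
  assume "1 \<le> n \<and> disjoint_triangles n V E"
  then show "sum_index V E = min_choose3 n"
    using sum_index_eq_min_choose3 by blast
next
  fix V :: "nat \<Rightarrow> 'a set" and E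
  assume tri: "\<forall>n\<ge>1. disjoint_triangles n (V n) (E n)"
  let ?g = "\<lambda>n. real (sum_index (V n) (E n)) - real (chromatic_index (E n))"
  let ?h = "\<lambda>n. real n powr (1 / 3)"
  \<comment> \<open>From \<open>n = 6 ^ 3\<close> on, subtracting at most 3 costs at most half of the cube root.\<close>
  have bounds: "?h n / 2 \<le> ?g n \<and> ?g n \<le> 4 * ?h n \<and> 0 \<le> ?h n" if n: "216 \<le> n" for n
  proof -
    have t: "disjoint_triangles n (V n) (E n)"
      using tri n by auto
    have "chromatic_index (E n) \<le> 3"
      using t by (auto elim: disjoint_trianglesE simp: triangles.chromatic_index_le)
    moreover have "sum_index (V n) (E n) = min_choose3 n"
      using sum_index_eq_min_choose3[OF _ t] n by simp
    moreover have "6 \<le> ?h n"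
    proof -
      have "(6::real) = (6 ^ 3) powr (1 / 3)"
        by (rule cube_powr_third[symmetric]) simp
      also have "\<dots> \<le> ?h n"
        using n by (intro powr_mono2) auto
      finally show ?thesis .
    qed
    ultimately show ?thesis
      using min_choose3_ge_cube_root[of n] min_choose3_le_cube_root[of n] n by auto
  qed
  show "?g \<in> \<Theta>(?h)"
  proof (rule bigthetaI)
    show "?g \<in> O(?h)"
      by (rule bigoI[where c = 4], rule eventually_sequentiallyI[of 216]) (use bounds in force)
    show "?g \<in> \<Omega>(?h)"
      by (rule landau_omega.bigI[where c = "1/2"], simp,
          rule eventually_sequentiallyI[of 216]) (use bounds in force)
  qed
qed

end
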